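(* Let $L$ be the Laplacian matrix of a connected graph with vertex set $\{1,\ldots,n\}$. Then every $L$-invariant anti-synchrony subspace of $\mathbb{R}^n$ is evenly tagged.
   Context: A graph is a pair $(V,E)$ with $V$ a finite vertex set and $E$ a set of edges, each edge being a set of two vertices (undirected, unweighted). Its Laplacian matrix is the usual graph Laplacian: $L_{i,j}=\left(\sum_{k=1}^nA_{i,k}\right)\delta_{i,j}-A_{i,j}$, where $A_{i,j}=1$ if $\{i,j\}\in E$ and $A_{i,j}=0$ otherwise. A subspace $V\subseteq\mathbb{R}^n$ is $L$-invariant if $LV\subseteq V$. A partial involution on a set $X$ is a map $x\mapsto x^*:\tilde X\to\tilde X$ defined on a (possibly empty) subset $\tilde X\subseteq X$ that is its own inverse. A tagged partition of a finite set $C$ is a partition $\mathcal{P}$ of $C$ (into nonempty classes) together with a partial involution $P\mapsto P^*$ on $\mathcal{P}$ that has at most one fixed point. The class of $i$ is denoted by $[i]$. For a tagged partition $\mathcal{P}$ of $\{1,\ldots,n\}$, the polydiagonal subspace is $$\Delta_{\mathcal{P}}=\{x\in\mathbb{R}^n\mid x_i=x_j\text{ if }[i]=[j],\text{ and }x_i=-x_j\text{ if }[i]^*=[j]\}.$$ Distinct tagged partitions give distinct polydiagonal subspaces. $\Delta_{\mathcal{P}}$ is an anti-synchrony subspace if the partial involution is not the empty function. $\Delta_{\mathcal{P}}$ is fully tagged if the partial involution is defined on all of $\mathcal{P}$, and evenly tagged if it is fully tagged and $\#P=\#P^*$ for all $P\in\mathcal{P}$. *)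

theory Defs
  imports "HOL-Analysis.Analysis" "HOL-Library.Disjoint_Sets"
begin

text \<open>The vertex set \<open>{1,\<dots>,n}\<close> is a finite type \<open>'n\<close> with \<open>n = CARD('n)\<close>, so that \<open>\<real>\<^sup>n\<close> is
  \<open>real ^ 'n\<close>; a graph on it is given by its edge set. Loops are excluded, as an edge has two
  elements.\<close>

definition graph :: "'n::finite set set \<Rightarrow> bool" where
  "graph E \<longleftrightarrow> (\<forall>e\<in>E. card e = 2)"

definition connected_graph :: "'n::finite set set \<Rightarrow> bool" where
  "connected_graph E \<longleftrightarrow> graph E \<and> (\<forall>i j. (i, j) \<in> {(u, v). {u, v} \<in> E}\<^sup>*)"

definition adjacency :: "'n::finite set set \<Rightarrow> real ^ 'n ^ 'n" where
  "adjacency E = (\<chi> i j. if {i, j} \<in> E then 1 else 0)"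

definition laplacian :: "'n::finite set set \<Rightarrow> real ^ 'n ^ 'n" where
  "laplacian E =
     (\<chi> i j. (\<Sum>k\<in>UNIV. adjacency E $ i $ k) * (if i = j then 1 else 0) - adjacency E $ i $ j)"

definition invariant_under :: "real ^ 'n ^ 'n \<Rightarrow> (real ^ 'n) set \<Rightarrow> bool" where
  "invariant_under L V \<longleftrightarrow> (\<lambda>x. L *v x) ` V \<subseteq> V"

definition partial_involution_on :: "'a set \<Rightarrow> ('a \<rightharpoonup> 'a) \<Rightarrow> bool" where
  "partial_involution_on X s \<longleftrightarrow>
     dom s \<subseteq> X \<and> ran s \<subseteq> dom s \<and> (\<forall>x y. s x = Some y \<longrightarrow> s y = Some x)"

definition tagged_partition :: "'a set \<Rightarrow> 'a set set \<Rightarrow> ('a set \<rightharpoonup> 'a set) \<Rightarrow> bool" where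
  "tagged_partition C \<P> s \<longleftrightarrow>
     partition_on C \<P> \<and> partial_involution_on \<P> s \<and>
     (\<forall>P Q. s P = Some P \<and> s Q = Some Q \<longrightarrow> P = Q)"

definition class_of :: "'a set set \<Rightarrow> 'a \<Rightarrow> 'a set" where
  "class_of \<P> i = (THE P. P \<in> \<P> \<and> i \<in> P)"

definition polydiagonal :: "'n::finite set set \<Rightarrow> ('n set \<rightharpoonup> 'n set) \<Rightarrow> (real ^ 'n) set" where
  "polydiagonal \<P> s =
     {x. \<forall>i j. (class_of \<P> i = class_of \<P> j \<longrightarrow> x $ i = x $ j) \<and>
               (s (class_of \<P> i) = Some (class_of \<P> j) \<longrightarrow> x $ i = - x $ j)}"

text \<open>The following properties of \<open>polydiagonal \<P> s\<close> are stated for the tagged partition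
  \<open>(\<P>, s)\<close>, which it determines uniquely.\<close>

definition anti_synchrony :: "'a set set \<Rightarrow> ('a set \<rightharpoonup> 'a set) \<Rightarrow> bool" where
  "anti_synchrony \<P> s \<longleftrightarrow> s \<noteq> Map.empty"

definition fully_tagged :: "'a set set \<Rightarrow> ('a set \<rightharpoonup> 'a set) \<Rightarrow> bool" where
  "fully_tagged \<P> s \<longleftrightarrow> dom s = \<P>"

definition evenly_tagged :: "'a set set \<Rightarrow> ('a set \<rightharpoonup> 'a set) \<Rightarrow> bool" where
  "evenly_tagged \<P> s \<longleftrightarrow> fully_tagged \<P> s \<and> (\<forall>P\<in>\<P>. card P = card (the (s P)))"

end

theory Submission
  imports Defs
begin

text \<open>Project the all-ones vector orthogonally onto the invariant subspace \<open>V\<close>. As \<open>L\<close> is symmetric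
  and kills the all-ones vector, it kills the projection, which by connectedness is a constant
  vector. A tagged class forces the constant to be its own negative, so the all-ones vector is
  orthogonal to \<open>V\<close>: every vector of \<open>V\<close> has coordinate sum zero. Applied to the indicator of a class
  \<open>P\<close> minus the indicator of \<open>P\<^sup>*\<close> (if any), which lies in \<open>V\<close>, this says that \<open>P\<^sup>*\<close> exists and that
  \<open>P\<close> and \<open>P\<^sup>*\<close> have the same size.\<close>

text \<open>In this difference form constant vectors are visibly in the kernel, and at a coordinate
  where \<open>x\<close> is maximal every summand is nonnegative.\<close>

lemma laplacian_mult_nth:
  "(laplacian E *v x) $ i = (\<Sum>k\<in>UNIV. adjacency E $ i $ k * (x $ i - x $ k))"
proof -
  have "(laplacian E *v x) $ i = (\<Sum>j\<in>UNIV. (if j = i then (\<Sum>k\<in>UNIV. adjacency E $ i $ k) * x $ j else 0)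
      - adjacency E $ i $ j * x $ j)"
    unfolding laplacian_def matrix_vector_mult_def by (auto simp: algebra_simps intro!: sum.cong)
  then show ?thesis
    by (simp add: sum_subtractf sum_distrib_right right_diff_distrib)
qed

lemma transpose_laplacian: "transpose (laplacian E) = laplacian E"
  by (auto simp: transpose_def laplacian_def adjacency_def vec_eq_iff insert_commute)

text \<open>Maximum principle: at a vertex where \<open>u\<close> attains its maximum
  \<open>M\<close>, the nonnegative summands of the difference form add up to 0, so each vanishes
  and every neighbour has value \<open>M\<close> too. Induction along a path from one maximal vertex
  reaches all vertices.\<close>

lemma laplacian_kernel_constant:
  assumes "connected_graph E" and "laplacian E *v u = 0"
  shows "u $ i = u $ j"
proof -
  define M where "M = Max (range (($) u))"
  have le: "u $ k \<le> M" for k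
    unfolding M_def by (rule Max_ge) auto
  have "M \<in> range (($) u)"
    unfolding M_def by (rule Max_in) auto
  then obtain m where m: "u $ m = M" by auto
  have step: "u $ l = M" if "u $ k = M" and "{k, l} \<in> E" for k l
  proof -
    have nonneg: "0 \<le> adjacency E $ k $ h * (u $ k - u $ h)" for h
      using le[of h] \<open>u $ k = M\<close> by (simp add: adjacency_def)
    have "(\<Sum>h\<in>UNIV. adjacency E $ k $ h * (u $ k - u $ h)) = 0"
      using assms(2) laplacian_mult_nth[of E u k] by simp
    then have "adjacency E $ k $ l * (u $ k - u $ l) = 0"
      using nonneg by (simp add: sum_nonneg_eq_0_iff)
    then show ?thesis using that by (simp add: adjacency_def)
  qed
  have "u $ k = M" for k
  proof -
    have "(m, k) \<in> {(u, v). {u, v} \<in> E}\<^sup>*"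
      using assms(1) by (simp add: connected_graph_def)
    then show ?thesis by induction (use m step in auto)
  qed
  then show ?thesis by simp
qed

lemma subspace_polydiagonal:
  fixes \<P> :: "'n::finite set set"
  shows "subspace (polydiagonal \<P> s)"
proof -
  have "polydiagonal \<P> s =
      (\<Inter>(i, j)\<in>{(i, j). class_of \<P> i = class_of \<P> j}. {x. x $ i - x $ j = 0}) \<inter>
      (\<Inter>(i, j)\<in>{(i, j). s (class_of \<P> i) = Some (class_of \<P> j)}. {x. x $ i + x $ j = 0})"
    unfolding polydiagonal_def by (simp add: set_eq_iff eq_neg_iff_add_eq_0) blast
  moreover have "subspace {x :: real ^ 'n. x $ i - x $ j = 0}"
    and "subspace {x :: real ^ 'n. x $ i + x $ j = 0}" for i j :: 'n
    by (auto simp: subspace_def algebra_simps simp flip: distrib_left)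
  ultimately show ?thesis
    by (auto intro!: subspace_inter subspace_Inter)
qed

lemma class_of_eq:
  assumes "partition_on UNIV \<P>" "P \<in> \<P>"
  shows "class_of \<P> i = P \<longleftrightarrow> i \<in> P"
proof -
  obtain Q where Q: "Q \<in> \<P>" "i \<in> Q"
    using assms(1) by (metis UNIV_I UnionE partition_onD1)
  have "R = Q" if "R \<in> \<P>" "i \<in> R" for R
    using partition_onD2[OF assms(1)] Q that by (auto simp: disjoint_def)
  moreover from this have "class_of \<P> i = Q"
    unfolding class_of_def using Q by (intro the_equality) blast+
  ultimately show ?thesis
    using Q assms(2) by blast
qed

lemma partial_involution_on_mem:
  assumes "partial_involution_on X s" "s P = Some Q"
  shows "P \<in> X" "Q \<in> X"
proof -
  have "P \<in> dom s" "Q \<in> ran s"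
    using assms(2) by (auto intro: ranI)
  then show "P \<in> X" "Q \<in> X"
    using assms(1) unfolding partial_involution_on_def by blast+
qed

lemma exists_class_of:
  assumes "partition_on UNIV \<P>" "P \<in> \<P>"
  obtains i where "class_of \<P> i = P"
proof -
  have "P \<noteq> {}"
    using assms partition_onD3 by blast
  then show ?thesis
    using that class_of_eq[OF assms] by auto
qed

lemma orthogonal_ones_invariant_polydiagonal:
  fixes E :: "'n::finite set set"
  assumes "connected_graph E" "tagged_partition UNIV \<P> s" "anti_synchrony \<P> s"
    and inv: "invariant_under (laplacian E) (polydiagonal \<P> s)"
    and "x \<in> polydiagonal \<P> s"
  shows "(\<Sum>i\<in>UNIV. x $ i) = 0"
proof -
  let ?L = "laplacian E" and ?V = "polydiagonal \<P> s"
  \<comment> \<open>The orthogonal decomposition below is relative to the span.\<close>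
  have "span ?V = ?V"
    by (simp add: subspace_polydiagonal)
  then obtain u w where u: "u \<in> ?V" and w: "\<And>v. v \<in> ?V \<Longrightarrow> w \<bullet> v = 0"
    and ones: "(1 :: real ^ 'n) = u + w"
    using orthogonal_subspace_decomp_exists[of ?V 1] by (metis orthogonal_def)
  have L_in: "?L *v v \<in> ?V" if "v \<in> ?V" for v
    using inv that by (auto simp: invariant_under_def)
  have "?L *v 1 = 0"
    by (simp add: vec_eq_iff laplacian_mult_nth)
  then have "?L *v u = - (?L *v w)"
    by (simp add: ones matrix_vector_right_distrib eq_neg_iff_add_eq_0)
  \<comment> \<open>One factor \<open>L u\<close> is replaced by \<open>- L w\<close>, and symmetry
    moves that \<open>L\<close> to the other side. Invariance, used twice, puts
    \<open>L (L u)\<close> into \<open>?V\<close>, to which \<open>w\<close> is orthogonal; hence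
    \<open>L u\<close> has norm 0.\<close>
  then have "(?L *v u) \<bullet> (?L *v u) = - (w \<bullet> (?L *v (?L *v u)))"
    using dot_lmul_matrix[of w ?L "?L *v u"] transpose_matrix_vector[of ?L w]
    by (simp add: transpose_laplacian)
  then have "?L *v u = 0"
    using w[OF L_in[OF L_in[OF u]]] by simp
  then have const: "u $ i = u $ j" for i j
    by (rule laplacian_kernel_constant[OF assms(1)])
  obtain P Q where "s P = Some Q"
    using assms(3) by (auto simp: anti_synchrony_def fun_eq_iff)
  moreover have part: "partition_on UNIV \<P>" and "partial_involution_on \<P> s"
    using assms(2) by (simp_all add: tagged_partition_def)
  ultimately have PQ: "s P = Some Q" "P \<in> \<P>" "Q \<in> \<P>"
    using partial_involution_on_mem by metis+
  obtain i j where "class_of \<P> i = P" "class_of \<P> j = Q"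
    using exists_class_of[OF part] PQ by metis
  \<comment> \<open>This includes the case of a self-paired class, \<open>P = Q\<close>.\<close>
  then have "u $ i = - u $ j"
    using u PQ(1) unfolding polydiagonal_def by blast
  then have "u $ i = 0"
    using const[of i j] by simp
  then have "u = 0"
    using const by (metis vec_eq_iff zero_index)
  then have "1 \<bullet> x = 0"
    using w assms(5) ones by simp
  then show ?thesis
    by (simp add: inner_vec_def)
qed

text \<open>For a tagged pair \<open>Q\<close>, \<open>R\<close> the involution gives that
  \<open>Q\<close> is \<open>P\<close> iff \<open>R\<close> is the partner of \<open>P\<close>, and
  vice versa. So the two indicators swap between \<open>Q\<close> and \<open>R\<close>, and their
  difference changes sign. If \<open>P\<close> is its own partner, the vector is 0.\<close>

lemma class_indicator_in_polydiagonal: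
  assumes "partial_involution_on \<P> s"
  shows "(\<chi> i. of_bool (class_of \<P> i = P) - of_bool (s P = Some (class_of \<P> i))) \<in> polydiagonal \<P> s"
proof -
  have "Q = P \<longleftrightarrow> s P = Some R" "R = P \<longleftrightarrow> s P = Some Q" if "s Q = Some R" for Q R
    using assms that unfolding partial_involution_on_def by (metis option.inject)+
  then show ?thesis
    unfolding polydiagonal_def by simp
qed

theorem theorem6p17:
  fixes E :: "'n::finite set set"
    and \<P> :: "'n set set"
    and s :: "'n set \<rightharpoonup> 'n set"
  assumes "connected_graph E"
    and "tagged_partition UNIV \<P> s"
    and "anti_synchrony \<P> s"
    and "invariant_under (laplacian E) (polydiagonal \<P> s)"
  shows "evenly_tagged \<P> s"
proof -
  have part: "partition_on UNIV \<P>" and invol: "partial_involution_on \<P> s"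
    using assms(2) by (auto simp: tagged_partition_def)
  have tag: "\<exists>Q. s P = Some Q \<and> card P = card Q" if P: "P \<in> \<P>" for P
  proof -
    have "(\<Sum>i\<in>UNIV. of_bool (class_of \<P> i = P) - of_bool (s P = Some (class_of \<P> i)) :: real) = 0"
      using orthogonal_ones_invariant_polydiagonal[OF assms
          class_indicator_in_polydiagonal[OF invol, of P]] by simp
    then have sum: "real (card P) = (\<Sum>i\<in>UNIV. of_bool (s P = Some (class_of \<P> i)))"
      by (simp add: sum_subtractf class_of_eq[OF part P] of_bool_def sum.If_cases)
    have "card P > 0"
      using P partition_onD3[OF part] by (auto simp: card_gt_0_iff)
    \<comment> \<open>Without a partner the right-hand sum would be 0, but \<open>P\<close> is
      nonempty.\<close>
    with sum obtain Q where Q: "s P = Some Q"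
      by (cases "s P") auto
    then have "Q \<in> \<P>"
      by (rule partial_involution_on_mem[OF invol])
    then have "s P = Some (class_of \<P> i) \<longleftrightarrow> i \<in> Q" for i
      using Q class_of_eq[OF part, of Q i] by auto
    then have "card P = card Q"
      using sum by (simp add: of_bool_def sum.If_cases)
    with Q show ?thesis by blast
  qed
  have "dom s \<subseteq> \<P>"
    using invol by (simp add: partial_involution_on_def)
  with tag show ?thesis
    unfolding evenly_tagged_def fully_tagged_def by (fastforce simp: dom_def)
qed

end
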